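(* Let $q\in\mathbb{C}\setminus\{0\}$, $|q|\neq 1$, and let $A(z)$ be a meromorphic function with $A(z)\not\equiv-\frac{1}{(q-1)z}$. If the $q$-difference Riccati equation $$f(qz)=\frac{A(z)+f(z)}{1-(q-1)z f(z)}$$ possesses three distinct meromorphic solutions $f_0(z), f_1(z)$ and $f_2(z)$, then all meromorphic solutions of this equation constitute the one-parameter family $$\left\{f_{0}(z),\ f(z)=\frac{(f_{1}(z)-f_{0}(z))(f_{2}(z)-f_{0}(z))}{\phi(z)(f_{2}(z)-f_{1}(z))+(f_{2}(z)-f_{0}(z))}+f_{0}(z)\right\},$$ where $\phi(z)$ is any constant in $\mathbb{C}$, or any non-zero meromorphic function with $\phi(qz)=\phi(z)$. (That is, a meromorphic function is a solution if and only if it is $f_0$ or is of the displayed form for some such $\phi$.) When $\phi(z)\equiv 0$ one has $f(z)=f_1(z)$, and when $\phi(z)\equiv -1$ one has $f(z)=f_2(z)$.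
   Context: "Meromorphic" means meromorphic in the whole complex plane $\mathbb{C}$. A meromorphic solution of the equation is a meromorphic function $f$ with $1-(q-1)zf(z)\not\equiv 0$ satisfying the equation as an identity of meromorphic functions. *)

theory Defs
  imports "HOL-Complex_Analysis.Complex_Analysis"
begin

text \<open>
  A function that is \<open>meromorphic_on UNIV\<close> in the library's sense may take arbitrary values at
  its poles and on a further closed discrete set, and \<open>x / 0 = 0\<close>.  Two such functions represent
  the same meromorphic function iff they agree outside a closed discrete set; this is what
  \<open>f \<equiv> g\<close> means for meromorphic functions.
\<close>

definition mero_eq :: "(complex \<Rightarrow> complex) \<Rightarrow> (complex \<Rightarrow> complex) \<Rightarrow> bool"
  where "mero_eq f g \<longleftrightarrow> (\<forall>\<^sub>\<approx>z\<in>UNIV. f z = g z)"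

definition riccati_solution ::
    "complex \<Rightarrow> (complex \<Rightarrow> complex) \<Rightarrow> (complex \<Rightarrow> complex) \<Rightarrow> bool"
  where "riccati_solution q A f \<longleftrightarrow>
    f meromorphic_on UNIV \<and>
    \<not> mero_eq (\<lambda>z. 1 - (q - 1) * z * f z) (\<lambda>z. 0) \<and>
    mero_eq (\<lambda>z. f (q * z)) (\<lambda>z. (A z + f z) / (1 - (q - 1) * z * f z))"

definition riccati_parameter :: "complex \<Rightarrow> (complex \<Rightarrow> complex) \<Rightarrow> bool"
  where "riccati_parameter q \<phi> \<longleftrightarrow>
    (\<exists>c. \<phi> = (\<lambda>z. c)) \<or>
    (\<phi> meromorphic_on UNIV \<and> \<not> mero_eq \<phi> (\<lambda>z. 0) \<and> mero_eq (\<lambda>z. \<phi> (q * z)) \<phi>)"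

definition riccati_denom ::
    "(complex \<Rightarrow> complex) \<Rightarrow> (complex \<Rightarrow> complex) \<Rightarrow> (complex \<Rightarrow> complex) \<Rightarrow>
     (complex \<Rightarrow> complex) \<Rightarrow> complex \<Rightarrow> complex"
  where "riccati_denom f0 f1 f2 \<phi> z = \<phi> z * (f2 z - f1 z) + (f2 z - f0 z)"

definition riccati_family ::
    "(complex \<Rightarrow> complex) \<Rightarrow> (complex \<Rightarrow> complex) \<Rightarrow> (complex \<Rightarrow> complex) \<Rightarrow>
     (complex \<Rightarrow> complex) \<Rightarrow> complex \<Rightarrow> complex"
  where "riccati_family f0 f1 f2 \<phi> z =
    (f1 z - f0 z) * (f2 z - f0 z) / riccati_denom f0 f1 f2 \<phi> z + f0 z"

end

theory Submission
  imports Defs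
begin

text \<open>
  For fixed \<open>z\<close> the right-hand side of the equation is a Moebius transformation of \<open>f z\<close>, with
  determinant \<open>1 + (q - 1) z A z\<close>, and Moebius transformations preserve cross ratios.  Hence the
  cross ratio \<open>\<phi>\<close> of four solutions satisfies \<open>\<phi> (q z) = \<phi> z\<close>; solving for the fourth solution
  gives the family, which is a solution for every \<open>q\<close>-periodic \<open>\<phi>\<close>.  The value \<open>\<phi>\<close> that makes
  the denominator vanish belongs to the point at infinity in place of the fourth solution, and it
  is never \<open>q\<close>-periodic, because infinity is not a fixed point when \<open>(q - 1) z \<noteq> 0\<close>.
\<close>

section \<open>Moebius transformations\<close>

text \<open>The factor \<open>1 + t * a\<close> is the determinant of the transformation. Apart from
  it, the scaling of \<open>x - y\<close> splits into one factor for each point, which is why it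
  cancels in cross ratios.\<close>

lemma moebius_diff:
  fixes a t x y :: complex
  assumes "1 - t * x \<noteq> 0" "1 - t * y \<noteq> 0"
  shows "(a + x) / (1 - t * x) - (a + y) / (1 - t * y) =
    (x - y) * ((1 + t * a) / ((1 - t * x) * (1 - t * y)))"
  using assms by (simp add: divide_simps) algebra

text \<open>For distinct points \<open>x0\<close>, \<open>x1\<close>, \<open>x2\<close> this is
  normalised to match the parameter of the family: 0 at \<open>x = x1\<close>, -1 at
  \<open>x = x2\<close>, a pole at \<open>x = x0\<close>.\<close>

definition cross_ratio :: "complex \<Rightarrow> complex \<Rightarrow> complex \<Rightarrow> complex \<Rightarrow> complex"
  where "cross_ratio x0 x1 x2 x = (x2 - x0) * (x1 - x) / ((x - x0) * (x2 - x1))"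

text \<open>Each of the four points occurs once in the numerator and once in the denominator, so the
  factors from \<open>moebius_diff\<close> cancel. If a difference in the denominator vanishes, so
  does its image, and both sides are 0 by \<open>x / 0 = 0\<close>.\<close>

lemma cross_ratio_moebius:
  fixes a t :: complex
  defines "M \<equiv> \<lambda>x. (a + x) / (1 - t * x)"
  assumes "1 - t * x0 \<noteq> 0" "1 - t * x1 \<noteq> 0" "1 - t * x2 \<noteq> 0" "1 - t * x \<noteq> 0"
    and "1 + t * a \<noteq> 0"
  shows "cross_ratio (M x0) (M x1) (M x2) (M x) = cross_ratio x0 x1 x2 x"
  using assms(2-) by (simp add: cross_ratio_def M_def moebius_diff)

lemma cross_ratio_solve:
  assumes "x \<noteq> x0" "x1 \<noteq> x2" "x1 \<noteq> x0" "x2 \<noteq> x0"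
  shows "x = (x1 - x0) * (x2 - x0) / (cross_ratio x0 x1 x2 x * (x2 - x1) + (x2 - x0)) + x0"
proof -
  have "cross_ratio x0 x1 x2 x * (x2 - x1) + (x2 - x0) = (x1 - x0) * (x2 - x0) / (x - x0)"
    using assms by (simp add: cross_ratio_def divide_simps) (simp add: algebra_simps)
  then show ?thesis
    using assms by simp
qed

lemma denom_moebius:
  fixes a t p :: complex
  defines "M \<equiv> \<lambda>x. (a + x) / (1 - t * x)"
  assumes "1 - t * x0 \<noteq> 0" "1 - t * x1 \<noteq> 0" "1 - t * x2 \<noteq> 0"
  shows "p * (M x2 - M x1) + (M x2 - M x0) =
    (1 + t * a) * (p * (x2 - x1) * (1 - t * x0) + (x2 - x0) * (1 - t * x1))
      / ((1 - t * x0) * (1 - t * x1) * (1 - t * x2))"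
proof -
  have "p * (M x2 - M x1) + (M x2 - M x0) =
    p * ((x2 - x1) * ((1 + t * a) / ((1 - t * x2) * (1 - t * x1)))) +
      (x2 - x0) * ((1 + t * a) / ((1 - t * x2) * (1 - t * x0)))"
    using assms(2-) by (simp add: M_def moebius_diff)
  also have "\<dots> = (1 + t * a) * (p * (x2 - x1) * (1 - t * x0) + (x2 - x0) * (1 - t * x1))
      / ((1 - t * x0) * (1 - t * x1) * (1 - t * x2))"
  proof -
    \<comment> \<open>Differences, determinant and denominators become opaque variables, so that
      clearing fractions does not expand them.\<close>
    have *: "p * (u * (k / (e2 * e1))) + v * (k / (e2 * e0)) =
        k * (p * u * e0 + v * e1) / (e0 * e1 * e2)"
      if "e0 \<noteq> 0" "e1 \<noteq> 0" "e2 \<noteq> 0" for u v k e0 e1 e2 :: complex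
      using that by (simp add: divide_simps) algebra
    show ?thesis
      by (rule *) (use assms(2-) in auto)
  qed
  finally show ?thesis .
qed

text \<open>Solving the cross ratio equation for the fourth point commutes with \<open>M\<close>
  when \<open>p\<close> is fixed. By \<open>denom_moebius\<close>, \<open>D'\<close> forces both
  \<open>k\<close> and \<open>n\<close> to be nonzero; since \<open>1 - t * x = n / d\<close>, the
  point \<open>x\<close> is then not the pole of \<open>M\<close>.\<close>

lemma moebius_family:
  fixes a t p :: complex
  defines "M \<equiv> \<lambda>x. (a + x) / (1 - t * x)"
  assumes e: "1 - t * x0 \<noteq> 0" "1 - t * x1 \<noteq> 0" "1 - t * x2 \<noteq> 0"
    and D: "p * (x2 - x1) + (x2 - x0) \<noteq> 0"
    and D': "p * (M x2 - M x1) + (M x2 - M x0) \<noteq> 0"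
  defines "x \<equiv> (x1 - x0) * (x2 - x0) / (p * (x2 - x1) + (x2 - x0)) + x0"
  shows "1 - t * x \<noteq> 0"
    and "M x = (M x1 - M x0) * (M x2 - M x0) / (p * (M x2 - M x1) + (M x2 - M x0)) + M x0"
proof -
  define d where "d = p * (x2 - x1) + (x2 - x0)"
  define n where "n = p * (x2 - x1) * (1 - t * x0) + (x2 - x0) * (1 - t * x1)"
  define k where "k = 1 + t * a"
  have d: "d \<noteq> 0"
    using D by (simp add: d_def)
  have D'_eq: "p * (M x2 - M x1) + (M x2 - M x0) =
      k * n / ((1 - t * x0) * (1 - t * x1) * (1 - t * x2))"
    unfolding M_def n_def k_def by (rule denom_moebius[OF e])
  then have n: "n \<noteq> 0" and k: "k \<noteq> 0"
    using D' by auto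
  have "1 - t * x = (d * (1 - t * x0) - t * (x1 - x0) * (x2 - x0)) / d"
    using d by (simp add: x_def flip: d_def) (simp add: field_simps)
  also have "d * (1 - t * x0) - t * (x1 - x0) * (x2 - x0) = n"
    by (simp add: d_def n_def algebra_simps)
  finally have x: "1 - t * x = n / d" .
  then show nz: "1 - t * x \<noteq> 0"
    using n d by simp
  have M_diff: "M u - M v = (u - v) * (k / ((1 - t * u) * (1 - t * v)))"
    if "1 - t * u \<noteq> 0" "1 - t * v \<noteq> 0" for u v
    using that by (simp add: M_def k_def moebius_diff)
  have xx0: "x - x0 = (x1 - x0) * (x2 - x0) / d"
    by (simp add: x_def d_def)
  have "M x - M x0 = (x1 - x0) * (x2 - x0) / d * (k / (n / d * (1 - t * x0)))"
    using M_diff[OF nz e(1)] by (simp only: x xx0)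
  also have "\<dots> = (M x1 - M x0) * (M x2 - M x0) / (p * (M x2 - M x1) + (M x2 - M x0))"
  proof -
    have *: "u * v / d * (k / (n / d * e0)) =
        (u * (k / (e1 * e0))) * (v * (k / (e2 * e0))) / (k * n / (e0 * e1 * e2))"
      if "e0 \<noteq> 0" "e1 \<noteq> 0" "e2 \<noteq> 0" for u v e0 e1 e2 :: complex
      using that d n k by (simp add: divide_simps)
    show ?thesis
      unfolding D'_eq unfolding M_diff[OF e(2) e(1)] M_diff[OF e(3) e(1)] by (rule *[OF e])
  qed
  finally show "M x = (M x1 - M x0) * (M x2 - M x0) /
      (p * (M x2 - M x1) + (M x2 - M x0)) + M x0"
    by (simp add: algebra_simps)
qed

section \<open>Identities of meromorphic functions\<close>

text \<open>The identity theorem, applied to \<open>f - g\<close>. It turns each hypothesis of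
  non-identity into a pointwise inequality outside a sparse set, so that the algebra above applies
  at generic \<open>z\<close>.\<close>

lemma not_mero_eq_imp_avoid:
  assumes "f meromorphic_on UNIV" "g meromorphic_on UNIV" "\<not> mero_eq f g"
  shows "\<forall>\<^sub>\<approx>z\<in>UNIV. f z \<noteq> g z"
proof -
  have "(\<lambda>z. f z - g z) meromorphic_on UNIV"
    using assms by (intro meromorphic_intros)
  from meromorphic_imp_constant_or_avoid[OF this, of 0] assms(3) show ?thesis
    by (auto simp: mero_eq_def)
qed

lemma eventually_neq_imp_not_mero_eq:
  assumes "\<forall>\<^sub>\<approx>z\<in>UNIV. f z \<noteq> g z"
  shows "\<not> mero_eq f g"
proof
  assume "mero_eq f g"
  then have "\<forall>\<^sub>\<approx>z\<in>(UNIV :: complex set). False"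
    unfolding mero_eq_def using assms by eventually_elim simp
  then show False
    by (simp add: eventually_False)
qed

lemma eventually_nonzero: "\<forall>\<^sub>\<approx>z\<in>UNIV. z \<noteq> (0 :: complex)"
  using eventually_not_in_cosparse[of "{0 :: complex}" UNIV] by simp

text \<open>Multiplication by \<open>q\<close> maps punctured neighbourhoods of \<open>z\<close>
  into punctured neighbourhoods of \<open>q * z\<close>. Hence a property of generic
  \<open>z\<close> also holds at \<open>q * z\<close> for generic \<open>z\<close>.\<close>

lemma filterlim_cmult_cosparse:
  fixes q :: complex
  assumes "q \<noteq> 0"
  shows "filterlim (\<lambda>z. q * z) (cosparse UNIV) (cosparse UNIV)"
  unfolding filterlim_iff
proof (intro allI impI)
  fix P :: "complex \<Rightarrow> bool" assume P: "\<forall>\<^sub>\<approx>z\<in>UNIV. P z"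
  show "\<forall>\<^sub>\<approx>z\<in>UNIV. P (q * z)"
    unfolding eventually_cosparse_open_eq[OF open_UNIV]
  proof
    fix z
    have "filterlim (\<lambda>z. q * z) (at (q * z)) (at z)"
      using assms by (auto simp: filterlim_at eventually_at_filter intro!: tendsto_intros)
    moreover have "eventually P (at (q * z))"
      using P by (simp add: eventually_cosparse_open_eq)
    ultimately show "eventually (\<lambda>z. P (q * z)) (at z)"
      by (auto simp: filterlim_iff)
  qed
qed

lemmas eventually_cosparse_cmult = eventually_compose_filterlim[OF _ filterlim_cmult_cosparse]

section \<open>The Riccati equation at generic points\<close>

lemma riccati_solution_mero_eq_cong:
  assumes "q \<noteq> 0" "f meromorphic_on UNIV" "mero_eq f g" "riccati_solution q A g"
  shows "riccati_solution q A f"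
proof -
  have fg: "\<forall>\<^sub>\<approx>z\<in>UNIV. f z = g z"
    using assms(3) by (simp add: mero_eq_def)
  have "\<not> (\<forall>\<^sub>\<approx>z\<in>UNIV. 1 - (q - 1) * z * f z = 0)"
  proof
    assume "\<forall>\<^sub>\<approx>z\<in>UNIV. 1 - (q - 1) * z * f z = 0"
    with fg have "\<forall>\<^sub>\<approx>z\<in>UNIV. 1 - (q - 1) * z * g z = 0"
      by eventually_elim simp
    with assms(4) show False
      by (simp add: riccati_solution_def mero_eq_def)
  qed
  moreover have "\<forall>\<^sub>\<approx>z\<in>UNIV. g (q * z) = (A z + g z) / (1 - (q - 1) * z * g z)"
    using assms(4) by (simp add: riccati_solution_def mero_eq_def)
  with fg eventually_cosparse_cmult[OF fg assms(1)]
  have "\<forall>\<^sub>\<approx>z\<in>UNIV. f (q * z) = (A z + f z) / (1 - (q - 1) * z * f z)"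
    by eventually_elim simp
  ultimately show ?thesis
    using assms(2) by (simp add: riccati_solution_def mero_eq_def)
qed

text \<open>Constants, including 0, are trivially periodic, so both kinds of parameter can be
  treated together.\<close>

lemma riccati_parameterD:
  assumes "riccati_parameter q \<phi>"
  shows "\<phi> meromorphic_on UNIV" "\<forall>\<^sub>\<approx>z\<in>UNIV. \<phi> (q * z) = \<phi> z"
  using assms by (auto simp: riccati_parameter_def mero_eq_def)

lemma riccati_solutionD:
  assumes "riccati_solution q A f"
  shows "f meromorphic_on UNIV"
    and "\<forall>\<^sub>\<approx>z\<in>UNIV. 1 - (q - 1) * z * f z \<noteq> 0"
    and "\<forall>\<^sub>\<approx>z\<in>UNIV. f (q * z) = (A z + f z) / (1 - (q - 1) * z * f z)"
proof -
  show f: "f meromorphic_on UNIV"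
    and "\<forall>\<^sub>\<approx>z\<in>UNIV. f (q * z) = (A z + f z) / (1 - (q - 1) * z * f z)"
    using assms by (simp_all add: riccati_solution_def mero_eq_def)
  show "\<forall>\<^sub>\<approx>z\<in>UNIV. 1 - (q - 1) * z * f z \<noteq> 0"
    using assms f unfolding riccati_solution_def
    by (intro not_mero_eq_imp_avoid[of _ "\<lambda>_. 0"] meromorphic_intros) auto
qed

text \<open>The excluded function \<open>A\<close> is exactly the one for which the determinant
  vanishes identically.\<close>

lemma riccati_determinant_nonzero:
  assumes "q \<noteq> 1" "A meromorphic_on UNIV" "\<not> mero_eq A (\<lambda>z. - (1 / ((q - 1) * z)))"
  shows "\<forall>\<^sub>\<approx>z\<in>UNIV. 1 + (q - 1) * z * A z \<noteq> 0"
proof -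
  have "\<forall>\<^sub>\<approx>z\<in>UNIV. A z \<noteq> - (1 / ((q - 1) * z))"
    using assms(2,3) by (intro not_mero_eq_imp_avoid meromorphic_intros)
  with eventually_nonzero show ?thesis
  proof eventually_elim
    case (elim z)
    show ?case
    proof
      assume "1 + (q - 1) * z * A z = 0"
      then have "(q - 1) * z * A z = -1"
        by (simp add: eq_neg_iff_add_eq_0 add.commute)
      then have "A z = - (1 / ((q - 1) * z))"
        using elim(1) assms(1) by (simp add: field_simps)
      with elim(2) show False
        by simp
    qed
  qed
qed

section \<open>The one-parameter family\<close>

lemma riccati_denom_nonzero:
  assumes q: "q \<noteq> 0" "q \<noteq> 1"
    and A: "A meromorphic_on UNIV" "\<not> mero_eq A (\<lambda>z. - (1 / ((q - 1) * z)))"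
    and sol: "riccati_solution q A f0" "riccati_solution q A f1" "riccati_solution q A f2"
    and ne: "\<not> mero_eq f0 f1" "\<not> mero_eq f0 f2"
    and \<phi>: "riccati_parameter q \<phi>"
  shows "\<not> mero_eq (riccati_denom f0 f1 f2 \<phi>) (\<lambda>z. 0)"
proof
  assume "mero_eq (riccati_denom f0 f1 f2 \<phi>) (\<lambda>z. 0)"
  then have D: "\<forall>\<^sub>\<approx>z\<in>UNIV. riccati_denom f0 f1 f2 \<phi> z = 0"
    by (simp add: mero_eq_def)
  have ne': "\<forall>\<^sub>\<approx>z\<in>UNIV. f0 z \<noteq> f1 z" "\<forall>\<^sub>\<approx>z\<in>UNIV. f0 z \<noteq> f2 z"
    by (intro not_mero_eq_imp_avoid ne sol[THEN riccati_solutionD(1)])+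
  have "\<forall>\<^sub>\<approx>z\<in>(UNIV :: complex set). False"
    using D eventually_cosparse_cmult[OF D q(1)] ne' eventually_nonzero
      riccati_parameterD(2)[OF \<phi>] riccati_determinant_nonzero[OF q(2) A]
      sol[THEN riccati_solutionD(2)] sol[THEN riccati_solutionD(3)]
  proof eventually_elim
    case (elim z)
    let ?t = "(q - 1) * z"
    let ?n = "\<phi> z * (f2 z - f1 z) * (1 - ?t * f0 z) + (f2 z - f0 z) * (1 - ?t * f1 z)"
    \<comment> \<open>The left-hand side is the denominator at \<open>q * z\<close>, rewritten with
      the equations for the three solutions and the periodicity of \<open>\<phi>\<close>.\<close>
    have "(1 + ?t * A z) * ?n / ((1 - ?t * f0 z) * (1 - ?t * f1 z) * (1 - ?t * f2 z)) = 0"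
      using elim(2) denom_moebius[OF elim(8-10), of "\<phi> z" "A z"]
      by (simp add: riccati_denom_def elim(6,11-13))
    then have "?n = 0"
      using elim(7-10) by simp
    \<comment> \<open>Vanishing at both \<open>z\<close> and \<open>q * z\<close> would make this
      product zero, but its three factors are generically nonzero.\<close>
    moreover have "?n - (1 - ?t * f0 z) * riccati_denom f0 f1 f2 \<phi> z =
        (f2 z - f0 z) * ?t * (f0 z - f1 z)"
      by (simp add: riccati_denom_def algebra_simps)
    ultimately have "(f2 z - f0 z) * ?t * (f0 z - f1 z) = 0"
      by (simp add: elim(1))
    then show False
      using elim(3-5) q(2) by simp
  qed
  then show False
    by (simp add: eventually_False)
qed

lemma riccati_family_solution:
  assumes q: "q \<noteq> 0"
    and sol: "riccati_solution q A f0" "riccati_solution q A f1" "riccati_solution q A f2"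
    and D: "\<not> mero_eq (riccati_denom f0 f1 f2 \<phi>) (\<lambda>z. 0)"
    and \<phi>: "riccati_parameter q \<phi>"
  shows "riccati_solution q A (riccati_family f0 f1 f2 \<phi>)"
proof -
  note mero = sol[THEN riccati_solutionD(1)] riccati_parameterD(1)[OF \<phi>]
  let ?F = "riccati_family f0 f1 f2 \<phi>"
  have denom: "riccati_denom f0 f1 f2 \<phi> meromorphic_on UNIV"
    unfolding riccati_denom_def[abs_def] by (intro meromorphic_intros mero)
  then have F: "?F meromorphic_on UNIV"
    unfolding riccati_family_def[abs_def] by (intro meromorphic_intros mero)
  have D': "\<forall>\<^sub>\<approx>z\<in>UNIV. riccati_denom f0 f1 f2 \<phi> z \<noteq> 0"
    using not_mero_eq_imp_avoid[OF denom _ D] by auto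
  \<comment> \<open>\<open>moebius_family\<close> gives both parts at once, with \<open>p\<close>
    the common value of \<open>\<phi>\<close> at \<open>z\<close> and \<open>q * z\<close>. It needs
    the denominator to be nonzero at both points.\<close>
  have "\<forall>\<^sub>\<approx>z\<in>UNIV. 1 - (q - 1) * z * ?F z \<noteq> 0 \<and>
      ?F (q * z) = (A z + ?F z) / (1 - (q - 1) * z * ?F z)"
    using D' eventually_cosparse_cmult[OF D' q] riccati_parameterD(2)[OF \<phi>]
      sol[THEN riccati_solutionD(2)] sol[THEN riccati_solutionD(3)]
  proof eventually_elim
    case (elim z)
    note * = moebius_family[where p = "\<phi> z" and a = "A z", OF elim(4-6)]
    show ?case
      using *[OF elim(1)[unfolded riccati_denom_def]] elim(2)
      by (simp add: riccati_family_def riccati_denom_def elim(3,7-9))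
  qed
  then have "\<forall>\<^sub>\<approx>z\<in>UNIV. 1 - (q - 1) * z * ?F z \<noteq> 0"
    and "\<forall>\<^sub>\<approx>z\<in>UNIV. ?F (q * z) = (A z + ?F z) / (1 - (q - 1) * z * ?F z)"
    by (simp_all add: eventually_conj_iff)
  then show ?thesis
    using F eventually_neq_imp_not_mero_eq[of "\<lambda>z. 1 - (q - 1) * z * ?F z" "\<lambda>_. 0"]
    by (simp add: riccati_solution_def mero_eq_def)
qed

lemma riccati_solution_in_family:
  assumes q: "q \<noteq> 0" "q \<noteq> 1"
    and A: "A meromorphic_on UNIV" "\<not> mero_eq A (\<lambda>z. - (1 / ((q - 1) * z)))"
    and sol: "riccati_solution q A f0" "riccati_solution q A f1" "riccati_solution q A f2"
      "riccati_solution q A f"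
    and ne: "\<not> mero_eq f0 f1" "\<not> mero_eq f0 f2" "\<not> mero_eq f1 f2" "\<not> mero_eq f f0"
  obtains \<phi> where "riccati_parameter q \<phi>" "mero_eq f (riccati_family f0 f1 f2 \<phi>)"
proof -
  note mero = sol[THEN riccati_solutionD(1)]
  have ne': "\<forall>\<^sub>\<approx>z\<in>UNIV. f0 z \<noteq> f1 z" "\<forall>\<^sub>\<approx>z\<in>UNIV. f0 z \<noteq> f2 z"
      "\<forall>\<^sub>\<approx>z\<in>UNIV. f1 z \<noteq> f2 z" "\<forall>\<^sub>\<approx>z\<in>UNIV. f z \<noteq> f0 z"
    by (intro not_mero_eq_imp_avoid ne mero)+
  define \<psi> where "\<psi> = (\<lambda>z. cross_ratio (f0 z) (f1 z) (f2 z) (f z))"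
  have \<psi>_mero: "\<psi> meromorphic_on UNIV"
    unfolding \<psi>_def cross_ratio_def by (intro meromorphic_intros mero)
  have \<psi>_periodic: "\<forall>\<^sub>\<approx>z\<in>UNIV. \<psi> (q * z) = \<psi> z"
    using riccati_determinant_nonzero[OF q(2) A]
      sol[THEN riccati_solutionD(2)] sol[THEN riccati_solutionD(3)]
  proof eventually_elim
    case (elim z)
    show ?case
      using cross_ratio_moebius[OF elim(2-5,1)] by (simp add: \<psi>_def elim(6-9))
  qed
  have f: "\<forall>\<^sub>\<approx>z\<in>UNIV. f z = riccati_family f0 f1 f2 \<psi> z"
    using ne'
  proof eventually_elim
    case (elim z)
    then show ?case
      using cross_ratio_solve[of "f z" "f0 z" "f1 z" "f2 z"]
      by (auto simp: riccati_family_def riccati_denom_def \<psi>_def)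
  qed
  show ?thesis
  \<comment> \<open>If \<open>\<psi>\<close> vanishes only generically, it need not be literally
    constant, and the periodic alternative of \<open>riccati_parameter\<close> excludes it; the
    constant function 0 then replaces it.\<close>
  proof (cases "mero_eq \<psi> (\<lambda>_. 0)")
    case False
    then show ?thesis
      using that[of \<psi>] \<psi>_mero \<psi>_periodic f by (simp add: riccati_parameter_def mero_eq_def)
  next
    case True
    then have "\<forall>\<^sub>\<approx>z\<in>UNIV. \<psi> z = 0"
      by (simp add: mero_eq_def)
    with f have "\<forall>\<^sub>\<approx>z\<in>UNIV. f z = riccati_family f0 f1 f2 (\<lambda>_. 0) z"
      by eventually_elim (simp add: riccati_family_def riccati_denom_def)
    then show ?thesis
      using that[of "\<lambda>_. 0"] by (auto simp: riccati_parameter_def mero_eq_def)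
  qed
qed

lemma riccati_family_0:
  assumes "\<forall>\<^sub>\<approx>z\<in>UNIV. f0 z \<noteq> f2 z" "mero_eq \<phi> (\<lambda>z. 0)"
  shows "mero_eq (riccati_family f0 f1 f2 \<phi>) f1"
  \<comment> \<open>The denominator reduces to \<open>f2 z - f0 z\<close>, which cancels.\<close>
  using assms unfolding mero_eq_def
  by eventually_elim (simp add: riccati_family_def riccati_denom_def)

lemma riccati_family_minus_1:
  assumes "\<forall>\<^sub>\<approx>z\<in>UNIV. f0 z \<noteq> f1 z" "mero_eq \<phi> (\<lambda>z. - 1)"
  shows "mero_eq (riccati_family f0 f1 f2 \<phi>) f2"
  \<comment> \<open>The denominator reduces to \<open>f1 z - f0 z\<close>, which cancels.\<close>
  using assms unfolding mero_eq_def
  by eventually_elim (simp add: riccati_family_def riccati_denom_def)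

theorem theorem2p2:
  fixes q :: complex and A f0 f1 f2 :: "complex \<Rightarrow> complex"
  assumes "q \<noteq> 0" and "norm q \<noteq> 1"
    and "A meromorphic_on UNIV"
    and "\<not> mero_eq A (\<lambda>z. - (1 / ((q - 1) * z)))"
    and "riccati_solution q A f0" and "riccati_solution q A f1" and "riccati_solution q A f2"
    and "\<not> mero_eq f0 f1" and "\<not> mero_eq f0 f2" and "\<not> mero_eq f1 f2"
  shows "(\<forall>\<phi>. riccati_parameter q \<phi> \<longrightarrow> \<not> mero_eq (riccati_denom f0 f1 f2 \<phi>) (\<lambda>z. 0)) \<and>
    (\<forall>f. f meromorphic_on UNIV \<longrightarrow>
      (riccati_solution q A f \<longleftrightarrow>
        mero_eq f f0 \<or> (\<exists>\<phi>. riccati_parameter q \<phi> \<and> mero_eq f (riccati_family f0 f1 f2 \<phi>)))) \<and>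
    (\<forall>\<phi>. mero_eq \<phi> (\<lambda>z. 0) \<longrightarrow> mero_eq (riccati_family f0 f1 f2 \<phi>) f1) \<and>
    (\<forall>\<phi>. mero_eq \<phi> (\<lambda>z. - 1) \<longrightarrow> mero_eq (riccati_family f0 f1 f2 \<phi>) f2)"
proof -
  have q1: "q \<noteq> 1"
    using assms(2) by auto
  note sol = assms(5-7)
  have denom: "\<not> mero_eq (riccati_denom f0 f1 f2 \<phi>) (\<lambda>z. 0)" if "riccati_parameter q \<phi>" for \<phi>
    using riccati_denom_nonzero[OF assms(1) q1 assms(3-9) that] .
  have "riccati_solution q A f \<longleftrightarrow>
      mero_eq f f0 \<or> (\<exists>\<phi>. riccati_parameter q \<phi> \<and> mero_eq f (riccati_family f0 f1 f2 \<phi>))"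
    (is "_ \<longleftrightarrow> ?family") if f: "f meromorphic_on UNIV" for f
  proof
    assume "riccati_solution q A f"
    then show ?family
      using riccati_solution_in_family[OF assms(1) q1 assms(3,4) sol _ assms(8-10)] by blast
  next
    assume ?family
    then show "riccati_solution q A f"
      using riccati_solution_mero_eq_cong[OF assms(1) f] sol(1)
        riccati_family_solution[OF assms(1) sol denom] by blast
  qed
  moreover have "\<forall>\<^sub>\<approx>z\<in>UNIV. f0 z \<noteq> f1 z" "\<forall>\<^sub>\<approx>z\<in>UNIV. f0 z \<noteq> f2 z"
    by (intro not_mero_eq_imp_avoid assms(8,9) sol[THEN riccati_solutionD(1)])+
  ultimately show ?thesis
    using denom riccati_family_0[of f0 f2] riccati_family_minus_1[of f0 f1] by blast
qed

end
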